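(* Let $\Sigma_1=(X_1,X_{1,0},S_1,U,\to_1,Y,h_1)$ and $\Sigma_2=(X_2,X_{2,0},S_2,U,\to_2,Y,h_2)$ be NTSs with common input set $U$ and output set $Y$. Suppose there exists an InitSOP bisimulation relation $\sim\subseteq X_1\times X_2$ between $\Sigma_1$ and $\Sigma_2$. Then $\Sigma_1$ is initial-state opaque if and only if $\Sigma_2$ is initial-state opaque.
   Context: A nondeterministic transition system (NTS) is a tuple $\Sigma=(X,X_0,S,U,\to,Y,h)$, where $X$ is a (possibly infinite) set of states, $X_0\subseteq X$ the initial states, $S\subseteq X$ the secret states, $U$ a (possibly infinite) set of inputs, $\to\subseteq X\times U\times X$ the transition relation (write $x\xrightarrow{u}x'$ for $(x,u,x')\in\to$), $Y$ a set of outputs and $h:X\to Y$ the output map. $U^*$ is the set of finite sequences $\alpha=\alpha(0)\cdots\alpha(|\alpha|-1)$ over $U$, including the empty one. For $\alpha\in U^*$, a run over $\alpha$ is a nonempty sequence of states $x_0x_1\dots x_k$ with $k\le|\alpha|$, $x_0\in X_0$ and $(x_j,\alpha(j),x_{j+1})\in\to$ for all $j\in\{0,\dots,k-1\}$; it is maximal if $k=|\alpha|$ or there is no $x'$ with $(x_k,\alpha(k),x')\in\to$. $\Sigma$ is initial-state opaque if for every $\alpha\in U^*$ and every maximal run $x_0\dots x_k$ over $\alpha$ with $x_0\in X_0\cap S$, there is a maximal run $x_0'\dots x_k'$ over $\alpha$ with $x_0'\notin S$ and $h(x_j)=h(x_j')$ for all $j\in\{0,\dots,k\}$. A relation $\sim\subseteq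 X_1\times X_2$ is an InitSOP bisimulation relation between $\Sigma_1$ and $\Sigma_2$ if: (1a) for every $x_{1,0}\in X_{1,0}\cap S_1$ there is $x_{2,0}\in X_{2,0}\cap S_2$ with $(x_{1,0},x_{2,0})\in\sim$; (1b) for every $x_{1,0}\in X_{1,0}\setminus S_1$ there is $x_{2,0}\in X_{2,0}\setminus S_2$ with $(x_{1,0},x_{2,0})\in\sim$; (1c) for every $x_{2,0}\in X_{2,0}\cap S_2$ there is $x_{1,0}\in X_{1,0}\cap S_1$ with $(x_{1,0},x_{2,0})\in\sim$; (1d) for every $x_{2,0}\in X_{2,0}\setminus S_2$ there is $x_{1,0}\in X_{1,0}\setminus S_1$ with $(x_{1,0},x_{2,0})\in\sim$; (2) $h_1(x_1)=h_2(x_2)$ for all $(x_1,x_2)\in\sim$; (3a) for every $(x_1,x_2)\in\sim$ and every transition $x_1\xrightarrow{u}_1x_1'$ there is a transition $x_2\xrightarrow{u}_2x_2'$ (same input $u$) with $(x_1',x_2')\in\sim$; (3b) for every $(x_1,x_2)\in\sim$ and every transition $x_2\xrightarrow{u}_2x_2'$ there is a transition $x_1\xrightarrow{u}_1x_1'$ with $(x_1',x_2')\in\sim$. *)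

theory Defs
  imports Main
begin

record ('x, 'u, 'y) transition_system =
  states :: "'x set"
  init :: "'x set"
  secret :: "'x set"
  inputs :: "'u set"
  trans_rel :: "('x \<times> 'u \<times> 'x) set"
  outputs :: "'y set"
  out_map :: "'x \<Rightarrow> 'y"

text \<open>The sets of states, inputs and outputs are explicit carriers, so that the type variables
  impose no restriction on them; values of the output map outside the states are irrelevant.\<close>

definition nts :: "('x, 'u, 'y) transition_system \<Rightarrow> bool" where
  "nts \<Sigma> \<longleftrightarrow>
     init \<Sigma> \<subseteq> states \<Sigma> \<and>
     secret \<Sigma> \<subseteq> states \<Sigma> \<and>
     trans_rel \<Sigma> \<subseteq> states \<Sigma> \<times> inputs \<Sigma> \<times> states \<Sigma> \<and>
     (\<forall>x\<in>states \<Sigma>. out_map \<Sigma> x \<in> outputs \<Sigma>)"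

text \<open>A sequence $x_0 \ldots x_k$ is a list \<open>xs\<close> of length $k + 1$.\<close>

definition run_over :: "('x, 'u, 'y) transition_system \<Rightarrow> 'u list \<Rightarrow> 'x list \<Rightarrow> bool" where
  "run_over \<Sigma> \<alpha> xs \<longleftrightarrow>
     xs \<noteq> [] \<and> set xs \<subseteq> states \<Sigma> \<and> length xs - 1 \<le> length \<alpha> \<and>
     xs ! 0 \<in> init \<Sigma> \<and>
     (\<forall>j < length xs - 1. (xs ! j, \<alpha> ! j, xs ! (j + 1)) \<in> trans_rel \<Sigma>)"

definition maximal_run_over :: "('x, 'u, 'y) transition_system \<Rightarrow> 'u list \<Rightarrow> 'x list \<Rightarrow> bool" where
  "maximal_run_over \<Sigma> \<alpha> xs \<longleftrightarrow>
     run_over \<Sigma> \<alpha> xs \<and>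
     (length xs - 1 = length \<alpha> \<or>
      \<not> (\<exists>x'. (xs ! (length xs - 1), \<alpha> ! (length xs - 1), x') \<in> trans_rel \<Sigma>))"

definition initial_state_opaque :: "('x, 'u, 'y) transition_system \<Rightarrow> bool" where
  "initial_state_opaque \<Sigma> \<longleftrightarrow>
     (\<forall>\<alpha> \<in> lists (inputs \<Sigma>). \<forall>xs.
        maximal_run_over \<Sigma> \<alpha> xs \<and> xs ! 0 \<in> init \<Sigma> \<inter> secret \<Sigma> \<longrightarrow>
        (\<exists>xs'. maximal_run_over \<Sigma> \<alpha> xs' \<and> length xs' = length xs \<and>
               xs' ! 0 \<notin> secret \<Sigma> \<and>
               (\<forall>j < length xs. out_map \<Sigma> (xs ! j) = out_map \<Sigma> (xs' ! j))))"

definition InitSOP_bisimulation ::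
  "('x1, 'u, 'y) transition_system \<Rightarrow> ('x2, 'u, 'y) transition_system \<Rightarrow> ('x1 \<times> 'x2) set \<Rightarrow> bool"
where
  "InitSOP_bisimulation \<Sigma>1 \<Sigma>2 R \<longleftrightarrow>
     R \<subseteq> states \<Sigma>1 \<times> states \<Sigma>2 \<and>
     (\<forall>x1 \<in> init \<Sigma>1 \<inter> secret \<Sigma>1. \<exists>x2 \<in> init \<Sigma>2 \<inter> secret \<Sigma>2. (x1, x2) \<in> R) \<and>
     (\<forall>x1 \<in> init \<Sigma>1 - secret \<Sigma>1. \<exists>x2 \<in> init \<Sigma>2 - secret \<Sigma>2. (x1, x2) \<in> R) \<and>
     (\<forall>x2 \<in> init \<Sigma>2 \<inter> secret \<Sigma>2. \<exists>x1 \<in> init \<Sigma>1 \<inter> secret \<Sigma>1. (x1, x2) \<in> R) \<and>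
     (\<forall>x2 \<in> init \<Sigma>2 - secret \<Sigma>2. \<exists>x1 \<in> init \<Sigma>1 - secret \<Sigma>1. (x1, x2) \<in> R) \<and>
     (\<forall>(x1, x2) \<in> R. out_map \<Sigma>1 x1 = out_map \<Sigma>2 x2) \<and>
     (\<forall>(x1, x2) \<in> R. \<forall>u x1'. (x1, u, x1') \<in> trans_rel \<Sigma>1 \<longrightarrow>
        (\<exists>x2'. (x2, u, x2') \<in> trans_rel \<Sigma>2 \<and> (x1', x2') \<in> R)) \<and>
     (\<forall>(x1, x2) \<in> R. \<forall>u x2'. (x2, u, x2') \<in> trans_rel \<Sigma>2 \<longrightarrow>
        (\<exists>x1'. (x1, u, x1') \<in> trans_rel \<Sigma>1 \<and> (x1', x2') \<in> R))"

end

theory Submission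
  imports Defs
begin

text \<open>Matching a run step by step along the bisimulation gives a pointwise related run with the
  same outputs, starting from any chosen partner of the initial state; since related states enable
  the same inputs, the matched run is again maximal. Opacity is then transported by sending a
  secret run of one system to a secret run of the other, applying opacity there, and sending the
  non-secret witness back. The converse relation gives the other direction.\<close>

text \<open>The defining conditions come in mirrored pairs, so passing to \<open>R\<inverse>\<close>
  only permutes the conjuncts once the output equation is reoriented. Hence the lifting lemmas need
  to be proved in one direction only.\<close>

lemma InitSOP_bisimulation_converse:
  "InitSOP_bisimulation \<Sigma>1 \<Sigma>2 R \<Longrightarrow> InitSOP_bisimulation \<Sigma>2 \<Sigma>1 (R\<inverse>)"
proof -
  have ball: "(\<forall>(y, x) \<in> R\<inverse>. P y x) \<longleftrightarrow> (\<forall>(x, y) \<in> R. P y x)" for P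
    by auto
  have sub: "R\<inverse> \<subseteq> states \<Sigma>2 \<times> states \<Sigma>1 \<longleftrightarrow> R \<subseteq> states \<Sigma>1 \<times> states \<Sigma>2"
    by auto
  assume "InitSOP_bisimulation \<Sigma>1 \<Sigma>2 R"
  then show ?thesis
    unfolding InitSOP_bisimulation_def ball sub converse_iff eq_commute[of "out_map \<Sigma>2 _"]
    by (elim conjE, intro conjI)
qed

lemma InitSOP_bisimulationD:
  assumes "InitSOP_bisimulation \<Sigma>1 \<Sigma>2 R" "(x, y) \<in> R"
  shows InitSOP_bisimulation_states: "y \<in> states \<Sigma>2"
    and InitSOP_bisimulation_out_map: "out_map \<Sigma>1 x = out_map \<Sigma>2 y"
    and InitSOP_bisimulation_step:
      "(x, u, x') \<in> trans_rel \<Sigma>1 \<Longrightarrow> \<exists>y'. (y, u, y') \<in> trans_rel \<Sigma>2 \<and> (x', y') \<in> R"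
proof -
  note D = assms(1)[unfolded InitSOP_bisimulation_def]
  show "y \<in> states \<Sigma>2" using D[THEN conjunct1] assms(2) by blast
  show "out_map \<Sigma>1 x = out_map \<Sigma>2 y" using D assms(2) by (elim conjE) fast
  show "\<exists>y'. (y, u, y') \<in> trans_rel \<Sigma>2 \<and> (x', y') \<in> R" if "(x, u, x') \<in> trans_rel \<Sigma>1"
    using D[THEN conjunct2, THEN conjunct2, THEN conjunct2, THEN conjunct2, THEN conjunct2,
        THEN conjunct2, THEN conjunct1] assms(2) that by fast
qed

text \<open>Induction at the end of the list fits the indexing: removing the last state leaves the
  positions in \<alpha> of all other transitions unchanged. Keeping \<open>y\<close> arbitrary lets
  the caller decide whether the lifted path starts in a secret state.\<close>

lemma InitSOP_bisimulation_path_lift: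
  assumes R: "InitSOP_bisimulation \<Sigma>1 \<Sigma>2 R"
    and "xs \<noteq> []" "(xs ! 0, y) \<in> R"
    and "\<forall>j < length xs - 1. (xs ! j, \<alpha> ! j, xs ! (j + 1)) \<in> trans_rel \<Sigma>1"
  obtains ys where "list_all2 (\<lambda>x y. (x, y) \<in> R) xs ys" "ys ! 0 = y"
    "\<forall>j < length ys - 1. (ys ! j, \<alpha> ! j, ys ! (j + 1)) \<in> trans_rel \<Sigma>2"
proof -
  have "\<exists>ys. list_all2 (\<lambda>x y. (x, y) \<in> R) xs ys \<and> ys ! 0 = y \<and>
    (\<forall>j < length ys - 1. (ys ! j, \<alpha> ! j, ys ! (j + 1)) \<in> trans_rel \<Sigma>2)"
    using assms(2-)
  proof (induction xs rule: rev_nonempty_induct)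
    case (single x)
    then show ?case by (intro exI[of _ "[y]"]) auto
  next
    case (snoc x xs)
    have "(xs ! j, \<alpha> ! j, xs ! (j + 1)) \<in> trans_rel \<Sigma>1" if "j < length xs - 1" for j
      using snoc.prems(2)[rule_format, of j] that by (simp add: nth_append less_diff_conv)
    moreover have "(xs ! 0, y) \<in> R"
      using snoc.prems(1) snoc.hyps by (simp add: nth_append)
    ultimately obtain ys where ys: "list_all2 (\<lambda>x y. (x, y) \<in> R) xs ys" "ys ! 0 = y"
      "\<forall>j < length ys - 1. (ys ! j, \<alpha> ! j, ys ! (j + 1)) \<in> trans_rel \<Sigma>2"
      using snoc.IH by blast
    have len: "length ys = length xs"
      using list_all2_lengthD[OF ys(1)] by simp
    \<comment> \<open>\<open>n\<close> is the index of the last state before \<open>x\<close>, so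
      \<alpha>\<open>! n\<close> labels the one new transition to be matched.\<close>
    obtain n where n: "length xs = Suc n"
      using snoc.hyps by (cases xs) auto
    have "(xs ! n, \<alpha> ! n, x) \<in> trans_rel \<Sigma>1"
      using snoc.prems(2)[rule_format, of n] n by (simp add: nth_append)
    moreover have "(xs ! n, ys ! n) \<in> R"
      using list_all2_nthD[OF ys(1), of n] n by simp
    ultimately obtain z where z: "(ys ! n, \<alpha> ! n, z) \<in> trans_rel \<Sigma>2" "(x, z) \<in> R"
      using InitSOP_bisimulation_step[OF R] by blast
    have "((ys @ [z]) ! j, \<alpha> ! j, (ys @ [z]) ! (j + 1)) \<in> trans_rel \<Sigma>2"
      if "j < length (ys @ [z]) - 1" for j
    proof (cases "j = n")
      case True
      then show ?thesis using z(1) len n by (simp add: nth_append)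
    next
      case False
      then show ?thesis using ys(3) that len n by (simp add: nth_append)
    qed
    then show ?case
      using ys(1,2) z(2) len snoc.hyps
      by (intro exI[of _ "ys @ [z]"]) (auto simp: nth_append intro: list_all2_appendI)
  qed
  then show thesis using that by blast
qed

text \<open>Equal lengths settle the case where all of \<alpha> is consumed. If instead the run is
  blocked early, its partner is blocked too, since the backward condition would turn any
  continuation of the partner into one of \<open>xs\<close>.\<close>

lemma maximal_run_over_lift:
  assumes R: "InitSOP_bisimulation \<Sigma>1 \<Sigma>2 R"
    and xs: "maximal_run_over \<Sigma>1 \<alpha> xs" and y: "(xs ! 0, y) \<in> R" "y \<in> init \<Sigma>2"
  obtains ys where "maximal_run_over \<Sigma>2 \<alpha> ys" "ys ! 0 = y" "length ys = length xs"
    "\<forall>j < length xs. out_map \<Sigma>1 (xs ! j) = out_map \<Sigma>2 (ys ! j)"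
proof -
  have ne: "xs \<noteq> []"
    and tr: "\<forall>j < length xs - 1. (xs ! j, \<alpha> ! j, xs ! (j + 1)) \<in> trans_rel \<Sigma>1"
    using xs unfolding maximal_run_over_def run_over_def by auto
  obtain ys where ys: "list_all2 (\<lambda>x y. (x, y) \<in> R) xs ys" "ys ! 0 = y"
    "\<forall>j < length ys - 1. (ys ! j, \<alpha> ! j, ys ! (j + 1)) \<in> trans_rel \<Sigma>2"
    using InitSOP_bisimulation_path_lift[OF R ne y(1) tr] .
  have len: "length ys = length xs" using list_all2_lengthD[OF ys(1)] by simp
  have rel: "(xs ! j, ys ! j) \<in> R" if "j < length xs" for j
    using list_all2_nthD[OF ys(1) that] .
  have sub: "set ys \<subseteq> states \<Sigma>2"
  proof
    fix z assume "z \<in> set ys"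
    then obtain j where "j < length xs" "z = ys ! j"
      using len by (auto simp: in_set_conv_nth)
    then show "z \<in> states \<Sigma>2"
      using InitSOP_bisimulation_states[OF R rel] by simp
  qed
  have "run_over \<Sigma>2 \<alpha> ys"
    using xs ys(2,3) y(2) len sub ne unfolding maximal_run_over_def run_over_def by auto
  moreover have "(xs ! (length xs - 1), ys ! (length xs - 1)) \<in> R"
    using rel ne by simp
  \<comment> \<open>The backward condition, applied to the related last states.\<close>
  then have "\<exists>x'. (xs ! (length xs - 1), u, x') \<in> trans_rel \<Sigma>1"
    if "(ys ! (length xs - 1), u, y') \<in> trans_rel \<Sigma>2" for u y'
    using InitSOP_bisimulation_step[OF InitSOP_bisimulation_converse[OF R]] that by blast
  ultimately have "maximal_run_over \<Sigma>2 \<alpha> ys"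
    using xs len unfolding maximal_run_over_def by metis
  moreover have "\<forall>j < length xs. out_map \<Sigma>1 (xs ! j) = out_map \<Sigma>2 (ys ! j)"
    using InitSOP_bisimulation_out_map[OF R rel] by simp
  ultimately show thesis using that ys(2) len by blast
qed

lemma initial_state_opaque_transfer:
  assumes R: "InitSOP_bisimulation \<Sigma>1 \<Sigma>2 R" and inp: "inputs \<Sigma>1 = inputs \<Sigma>2"
    and opaque: "initial_state_opaque \<Sigma>2"
  shows "initial_state_opaque \<Sigma>1"
  unfolding initial_state_opaque_def
proof (intro ballI allI impI, elim conjE)
  fix \<alpha> xs
  assume \<alpha>: "\<alpha> \<in> lists (inputs \<Sigma>1)" and xs: "maximal_run_over \<Sigma>1 \<alpha> xs"
    and secret: "xs ! 0 \<in> init \<Sigma>1 \<inter> secret \<Sigma>1"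
  \<comment> \<open>The partner must itself be secret, as opacity of \<Sigma>\<open>2\<close> speaks
    only of runs from secret initial states.\<close>
  obtain y where y: "(xs ! 0, y) \<in> R" "y \<in> init \<Sigma>2" "y \<in> secret \<Sigma>2"
    using R secret unfolding InitSOP_bisimulation_def by blast
  obtain ys where ys: "maximal_run_over \<Sigma>2 \<alpha> ys" "ys ! 0 = y" "length ys = length xs"
    "\<forall>j < length xs. out_map \<Sigma>1 (xs ! j) = out_map \<Sigma>2 (ys ! j)"
    using maximal_run_over_lift[OF R xs y(1,2)] .
  obtain ys' where ys': "maximal_run_over \<Sigma>2 \<alpha> ys'" "length ys' = length ys"
    "ys' ! 0 \<notin> secret \<Sigma>2" "\<forall>j < length ys. out_map \<Sigma>2 (ys ! j) = out_map \<Sigma>2 (ys' ! j)"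
    using opaque \<alpha> inp ys(1,2) y(2,3) unfolding initial_state_opaque_def by (metis IntI)
  \<comment> \<open>Opacity supplies only non-secrecy; that the state is initial comes from
    \<open>ys'\<close> being a run.\<close>
  have "ys' ! 0 \<in> init \<Sigma>2 - secret \<Sigma>2"
    using ys'(1,3) unfolding maximal_run_over_def run_over_def by blast
  then obtain x where x: "(ys' ! 0, x) \<in> R\<inverse>" "x \<in> init \<Sigma>1" "x \<notin> secret \<Sigma>1"
    using R unfolding InitSOP_bisimulation_def by blast
  obtain xs' where "maximal_run_over \<Sigma>1 \<alpha> xs'" "xs' ! 0 = x" "length xs' = length ys'"
    "\<forall>j < length ys'. out_map \<Sigma>2 (ys' ! j) = out_map \<Sigma>1 (xs' ! j)"
    using maximal_run_over_lift[OF InitSOP_bisimulation_converse[OF R] ys'(1) x(1,2)] .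
  \<comment> \<open>The outputs agree along the chain \<open>xs\<close>, \<open>ys\<close>,
    \<open>ys'\<close>, \<open>xs'\<close>, all of the same length.\<close>
  then show "\<exists>xs'. maximal_run_over \<Sigma>1 \<alpha> xs' \<and> length xs' = length xs \<and>
    xs' ! 0 \<notin> secret \<Sigma>1 \<and> (\<forall>j < length xs. out_map \<Sigma>1 (xs ! j) = out_map \<Sigma>1 (xs' ! j))"
    using x(3) ys(3,4) ys'(2,4) by (intro exI[of _ xs']) auto
qed

theorem theorem3p14:
  fixes \<Sigma>1 :: "('x1, 'u, 'y) transition_system"
    and \<Sigma>2 :: "('x2, 'u, 'y) transition_system"
  assumes "nts \<Sigma>1" and "nts \<Sigma>2"
    and "inputs \<Sigma>1 = inputs \<Sigma>2" and "outputs \<Sigma>1 = outputs \<Sigma>2"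
    and "\<exists>R. InitSOP_bisimulation \<Sigma>1 \<Sigma>2 R"
  shows "initial_state_opaque \<Sigma>1 \<longleftrightarrow> initial_state_opaque \<Sigma>2"
proof -
  obtain R where R: "InitSOP_bisimulation \<Sigma>1 \<Sigma>2 R"
    using assms(5) ..
  show ?thesis
    using initial_state_opaque_transfer[OF R assms(3)]
      initial_state_opaque_transfer[OF InitSOP_bisimulation_converse[OF R] assms(3)[symmetric]]
    by blast
qed

end
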